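(* Let $(\mathsf Q,\mathbf d)$ be a quiver with multiplicities having an irregular pole vertex $i$ with base vertex $j$, let $(\check{\mathsf Q},\check{\mathbf d})$ be its normalization at $i$, and let $\mathbf C,\check{\mathbf C}$ be the associated generalized Cartan matrices. Under the isomorphism $\tilde\varphi:\mathfrak h^*\to\check{\mathfrak h}^*$ (i.e. via $w\mapsto\tilde\varphi w\tilde\varphi^{-1}$), the Weyl group $W(\mathbf C)$ associated to $\mathbf C$ is isomorphic to the semidirect product $W(\check{\mathbf C})\rtimes\mathbb Z/2\mathbb Z$ of the Weyl group associated to $\check{\mathbf C}$ and $\mathbb Z/2\mathbb Z$ by the permutation $\sigma$ of the indices $i$ and $j$.
   Context: A quiver has finite sets of vertices $I$ and arrows, each arrow $h$ having a source $\mathsf s(h)$ and a target $\mathsf t(h)$ with $\mathsf s(h)\neq\mathsf t(h)$; $a_{kl}$ denotes the number of edges joining $k$ and $l$ in the underlying graph, $\mathbf A=(a_{kl})$. A quiver with multiplicities is a pair $(\mathsf Q,\mathbf d)$, $\mathbf d=(d_k)\in\mathbb Z_{>0}^I$; $\mathbf D=\operatorname{diag}(d_k)$, and $\mathbf C=2\,\mathrm{Id}-\mathbf A\mathbf D$ is the associated (symmetrizable) generalized Cartan matrix. $\mathfrak g(\mathbf C)$ is the Kac–Moody algebra, with Cartan subalgebra $\mathfrak h$, simple roots $\alpha_k$, simple reflections $s_k$ generating $W(\mathbf C)\subset\operatorname{GL}(\mathfrak h^* )$, root lattice $Q=\sum\mathbb Z\alpha_k$, and the non-degenerate invariant symmetric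 bilinear form on $\mathfrak h^*$ with $(\alpha_k,\alpha_l)=d_kc_{kl}$. A vertex $i$ is an irregular pole vertex with base vertex $j$ if $d_i>1$, $d_j=1$ and $a_{ik}=a_{ki}=\delta_{jk}$ for all $k\in I$. The normalization $(\check{\mathsf Q},\check{\mathbf d})$ at $i$: $\check d_i=1$, $\check d_k=d_k$ for $k\ne i$; $\check{\mathsf Q}$ has the same vertex set and is obtained from $\mathsf Q$ by (i) deleting the unique arrow joining $i$ and $j$; then (ii) for each arrow $h$ with $\mathsf t(h)=j$ drawing an arrow from $\mathsf s(h)$ to $i$; (iii) for each arrow $h$ with $\mathsf s(h)=j$ drawing an arrow from $i$ to $\mathsf t(h)$; (iv) finally drawing $d_i-2$ arrows from $j$ to $i$. Objects associated with $(\check{\mathsf Q},\check{\mathbf d})$ are written $\check{\mathbf C},\check{\mathfrak h},\check Q,\check\alpha_k,\check s_k$. $\varphi:Q\to\check Q$ is the linear map $\sum_kv_k\alpha_k\mapsto\sum_kv_k\check\alpha_k-v_i\check\alpha_j$; it preserves the bilinear forms and $\dim\mathfrak h=\dim\check{\mathfrak h}$, and $\tilde\varphi:\mathfrak h^*\to\check{\mathfrak h}^*$ is a linear isomorphism extending $\varphi$ and preserving the bilinear forms. The permutation $\sigma$ exchanging $i$ and $j$ and fixing the other indices leaves $\check{\mathbf C}$ unchanged, so it defines an involution of $W(\check{\mathbf C})$, $\check s_k\mapsto\check s_{\sigma(k)}$, i.e. a homomorphism $\mathbb Z/2\mathbb Z\to\operatorname{Aut}(W(\check{\mathbf C}))$;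 the semidirect product is taken with respect to it. *)

theory Defs
  imports
    "HOL-Analysis.Analysis"
    "HOL-Algebra.Algebra"
    "Graph_Theory.Digraph"
begin

section \<open>Quivers with multiplicities\<close>

text \<open>The vertex set \<open>I\<close> is the finite type \<open>'v\<close>, so that matrices indexed by \<open>I\<close> are elements
  of \<open>int^'v^'v\<close>.\<close>

definition quiver :: "('v::finite, 'a) pre_digraph \<Rightarrow> bool" where
  "quiver Q \<longleftrightarrow> fin_digraph Q \<and> loopfree_digraph Q \<and> verts Q = UNIV"

definition quiver_with_multiplicities ::
    "('v::finite, 'a) pre_digraph \<Rightarrow> ('v \<Rightarrow> nat) \<Rightarrow> bool" where
  "quiver_with_multiplicities Q d \<longleftrightarrow> quiver Q \<and> (\<forall>k. d k > 0)"

definition adj_matrix :: "('v::finite, 'a) pre_digraph \<Rightarrow> int^'v^'v" where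
  "adj_matrix Q = (\<chi> k l. int (card {h \<in> arcs Q. {tail Q h, head Q h} = {k, l}}))"

definition mult_matrix :: "('v::finite \<Rightarrow> nat) \<Rightarrow> int^'v^'v" where
  "mult_matrix d = (\<chi> k l. if k = l then int (d k) else 0)"

definition cartan_matrix :: "('v::finite, 'a) pre_digraph \<Rightarrow> ('v \<Rightarrow> nat) \<Rightarrow> int^'v^'v" where
  "cartan_matrix Q d = mat 2 - adj_matrix Q ** mult_matrix d"

definition irregular_pole_vertex ::
    "('v::finite, 'a) pre_digraph \<Rightarrow> ('v \<Rightarrow> nat) \<Rightarrow> 'v \<Rightarrow> 'v \<Rightarrow> bool" where
  "irregular_pole_vertex Q d i j \<longleftrightarrow> d i > 1 \<and> d j = 1 \<and>
     (\<forall>k. adj_matrix Q $ i $ k = of_bool (j = k) \<and> adj_matrix Q $ k $ i = of_bool (j = k))"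

text \<open>Arrows of the normalization: the arrows that are kept, a copy ending (resp. starting) at \<open>i\<close>
  of each remaining arrow ending (resp. starting) at \<open>j\<close>, and numbered arrows from \<open>j\<close> to \<open>i\<close>.\<close>

datatype 'a norm_arrow = Kept 'a | Copy_to 'a | Copy_from 'a | Extra nat

definition normalization ::
    "('v::finite, 'a) pre_digraph \<Rightarrow> ('v \<Rightarrow> nat) \<Rightarrow> 'v \<Rightarrow> 'v \<Rightarrow> ('v, 'a norm_arrow) pre_digraph" where
  "normalization Q d i j =
     (let R = {h \<in> arcs Q. {tail Q h, head Q h} \<noteq> {i, j}} in
      \<lparr> verts = verts Q,
        arcs = Kept ` R
             \<union> Copy_to ` {h \<in> R. head Q h = j}
             \<union> Copy_from ` {h \<in> R. tail Q h = j}
             \<union> Extra ` {..<d i - 2},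
        tail = (\<lambda>x. case x of Kept h \<Rightarrow> tail Q h | Copy_to h \<Rightarrow> tail Q h | Copy_from h \<Rightarrow> i | Extra n \<Rightarrow> j),
        head = (\<lambda>x. case x of Kept h \<Rightarrow> head Q h | Copy_to h \<Rightarrow> i | Copy_from h \<Rightarrow> head Q h | Extra n \<Rightarrow> i) \<rparr>)"

definition normalized_mult :: "('v \<Rightarrow> nat) \<Rightarrow> 'v \<Rightarrow> 'v \<Rightarrow> nat" where
  "normalized_mult d i = d(i := 1)"

section \<open>Cartan subalgebra and Weyl group\<close>

text \<open>\<open>\<hh>\<close> is a complex vector space whose underlying set is the type \<open>'h\<close> and whose scalar
  multiplication is \<open>sc\<close>; \<open>\<hh>\<^sup>*\<close> is the set of linear functionals, with pointwise operations.\<close>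

definition dual_space :: "(complex \<Rightarrow> 'h::ab_group_add \<Rightarrow> 'h) \<Rightarrow> ('h \<Rightarrow> complex) set" where
  "dual_space sc = {f. Vector_Spaces.linear sc (*) f}"

definition linear_on_dual ::
    "(complex \<Rightarrow> 'h::ab_group_add \<Rightarrow> 'h) \<Rightarrow> (('h \<Rightarrow> complex) \<Rightarrow> ('k \<Rightarrow> complex)) \<Rightarrow> bool" where
  "linear_on_dual sc T \<longleftrightarrow>
     (\<forall>f\<in>dual_space sc. \<forall>g\<in>dual_space sc. T (\<lambda>x. f x + g x) = (\<lambda>y. T f y + T g y)) \<and>
     (\<forall>c. \<forall>f\<in>dual_space sc. T (\<lambda>x. c * f x) = (\<lambda>y. c * T f y))"

definition GL_dual ::
    "(complex \<Rightarrow> 'h::ab_group_add \<Rightarrow> 'h) \<Rightarrow> (('h \<Rightarrow> complex) \<Rightarrow> ('h \<Rightarrow> complex)) monoid" where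
  "GL_dual sc = BijGroup (dual_space sc)
     \<lparr>carrier := {T \<in> Bij (dual_space sc). linear_on_dual sc T}\<rparr>"

text \<open>Kac's realization \<open>(\<hh>, {\<alpha>\<^sub>k}, {\<alpha>\<^sub>k\<^sup>\<or>})\<close> of a generalized Cartan matrix \<open>C\<close>, which is what
  the Cartan subalgebra of the Kac--Moody algebra of \<open>C\<close> is by construction; it is unique up to
  isomorphism.\<close>

definition cartan_realization ::
    "int^'v^'v \<Rightarrow> (complex \<Rightarrow> 'h::ab_group_add \<Rightarrow> 'h) \<Rightarrow> ('v::finite \<Rightarrow> 'h \<Rightarrow> complex) \<Rightarrow> ('v \<Rightarrow> 'h) \<Rightarrow> bool" where
  "cartan_realization C sc \<alpha> \<alpha>v \<longleftrightarrow>
     (\<exists>B. finite_dimensional_vector_space sc B \<and>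
          card B + rank ((\<chi> k l. of_int (C $ k $ l)) :: complex^'v^'v) = 2 * CARD('v)) \<and>
     (\<forall>k. \<alpha> k \<in> dual_space sc) \<and>
     (\<forall>c. (\<forall>x. (\<Sum>k\<in>UNIV. c k * \<alpha> k x) = 0) \<longrightarrow> (\<forall>k. c k = 0)) \<and>
     (\<forall>c. (\<Sum>k\<in>UNIV. sc (c k) (\<alpha>v k)) = 0 \<longrightarrow> (\<forall>k. c k = 0)) \<and>
     (\<forall>k l. \<alpha> l (\<alpha>v k) = of_int (C $ k $ l))"

definition simple_reflection ::
    "(complex \<Rightarrow> 'h::ab_group_add \<Rightarrow> 'h) \<Rightarrow> ('v \<Rightarrow> 'h \<Rightarrow> complex) \<Rightarrow> ('v \<Rightarrow> 'h) \<Rightarrow>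
     'v \<Rightarrow> ('h \<Rightarrow> complex) \<Rightarrow> ('h \<Rightarrow> complex)" where
  "simple_reflection sc \<alpha> \<alpha>v k =
     (\<lambda>f\<in>dual_space sc. (\<lambda>x. f x - f (\<alpha>v k) * \<alpha> k x))"

definition weyl_group ::
    "(complex \<Rightarrow> 'h::ab_group_add \<Rightarrow> 'h) \<Rightarrow> ('v \<Rightarrow> 'h \<Rightarrow> complex) \<Rightarrow> ('v \<Rightarrow> 'h) \<Rightarrow>
     (('h \<Rightarrow> complex) \<Rightarrow> ('h \<Rightarrow> complex)) monoid" where
  "weyl_group sc \<alpha> \<alpha>v =
     subgroup_generated (GL_dual sc) (range (simple_reflection sc \<alpha> \<alpha>v))"

text \<open>On \<open>\<hh>\<^sup>*\<close>, invariance of the form means invariance under the Weyl group; with the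
  normalization \<open>(\<alpha>\<^sub>k, \<alpha>\<^sub>k) = 2 d\<^sub>k\<close> it amounts to
  \<open>(\<alpha>\<^sub>k, f) = d\<^sub>k f(\<alpha>\<^sub>k\<^sup>\<or>)\<close> for all \<open>f\<close>.\<close>

definition standard_form ::
    "int^'v^'v \<Rightarrow> ('v::finite \<Rightarrow> nat) \<Rightarrow> (complex \<Rightarrow> 'h::ab_group_add \<Rightarrow> 'h) \<Rightarrow>
     ('v \<Rightarrow> 'h \<Rightarrow> complex) \<Rightarrow> ('v \<Rightarrow> 'h) \<Rightarrow>
     (('h \<Rightarrow> complex) \<Rightarrow> ('h \<Rightarrow> complex) \<Rightarrow> complex) \<Rightarrow> bool" where
  "standard_form C d sc \<alpha> \<alpha>v B \<longleftrightarrow>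
     (\<forall>f\<in>dual_space sc. \<forall>g\<in>dual_space sc. \<forall>g'\<in>dual_space sc.
        B f (\<lambda>x. g x + g' x) = B f g + B f g') \<and>
     (\<forall>c. \<forall>f\<in>dual_space sc. \<forall>g\<in>dual_space sc. B f (\<lambda>x. c * g x) = c * B f g) \<and>
     (\<forall>f\<in>dual_space sc. \<forall>g\<in>dual_space sc. B f g = B g f) \<and>
     (\<forall>f\<in>dual_space sc. (\<forall>g\<in>dual_space sc. B f g = 0) \<longrightarrow> f = (\<lambda>x. 0)) \<and>
     (\<forall>w\<in>carrier (weyl_group sc \<alpha> \<alpha>v). \<forall>f\<in>dual_space sc. \<forall>g\<in>dual_space sc.
        B (w f) (w g) = B f g) \<and>
     (\<forall>k l. B (\<alpha> k) (\<alpha> l) = of_nat (d k) * of_int (C $ k $ l))"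

definition root_comb :: "('v::finite \<Rightarrow> 'h \<Rightarrow> complex) \<Rightarrow> ('v \<Rightarrow> int) \<Rightarrow> 'h \<Rightarrow> complex" where
  "root_comb \<alpha> v = (\<lambda>x. \<Sum>k\<in>UNIV. of_int (v k) * \<alpha> k x)"

text \<open>\<open>w \<mapsto> T w T\<^sup>-\<^sup>1\<close>, for a bijection \<open>T\<close> between the two dual spaces.\<close>

definition transport ::
    "(complex \<Rightarrow> 'h::ab_group_add \<Rightarrow> 'h) \<Rightarrow> (complex \<Rightarrow> 'k::ab_group_add \<Rightarrow> 'k) \<Rightarrow>
     (('h \<Rightarrow> complex) \<Rightarrow> ('k \<Rightarrow> complex)) \<Rightarrow>
     (('h \<Rightarrow> complex) \<Rightarrow> ('h \<Rightarrow> complex)) \<Rightarrow> (('k \<Rightarrow> complex) \<Rightarrow> ('k \<Rightarrow> complex))" where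
  "transport sc sc' T w = (\<lambda>f\<in>dual_space sc'. T (w (inv_into (dual_space sc) T f)))"

section \<open>Semidirect products\<close>

text \<open>Intended for \<open>\<theta> \<in> hom H (AutoGroup N)\<close>.\<close>

definition semidirect_product ::
    "('n, 'x) monoid_scheme \<Rightarrow> ('m, 'y) monoid_scheme \<Rightarrow> ('m \<Rightarrow> 'n \<Rightarrow> 'n) \<Rightarrow> ('n \<times> 'm) monoid" where
  "semidirect_product N H \<theta> =
     \<lparr> carrier = carrier N \<times> carrier H,
       mult = (\<lambda>(n, h) (n', h'). (n \<otimes>\<^bsub>N\<^esub> \<theta> h n', h \<otimes>\<^bsub>H\<^esub> h')),
       one = (\<one>\<^bsub>N\<^esub>, \<one>\<^bsub>H\<^esub>) \<rparr>"

end

theory Submission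
  imports Defs
begin

text \<open>Conjugation by \<open>\<phi>\<close> turns \<open>s\<^sub>k\<close> for \<open>k \<noteq> i\<close> into \<open>s'\<^sub>k\<close>, and \<open>s\<^sub>i\<close> into the orthogonal
  reflection \<open>\<tau>\<close> in \<open>\<alpha>'\<^sub>i - \<alpha>'\<^sub>j\<close>, which exchanges \<open>\<alpha>'\<^sub>i\<close> and \<open>\<alpha>'\<^sub>j\<close>, fixes the other simple roots
  and satisfies \<open>\<tau> s'\<^sub>k \<tau> = s'\<^bsub>\<sigma>(k)\<^esub>\<close>. In particular \<open>s'\<^sub>i = \<tau> s'\<^sub>j \<tau>\<close>, so the image of \<open>W\<close> is generated
  by \<open>W'\<close> and \<open>\<tau>\<close>. That \<open>\<tau>\<close> lies outside \<open>W'\<close> needs no Coxeter theory: \<open>W'\<close> moves an integral weight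
  by elements of the root lattice only, whereas \<open>\<tau>\<close> moves a suitable integral weight by
  \<open>(\<alpha>'\<^sub>i - \<alpha>'\<^sub>j) / d\<^sub>i\<close>, and \<open>d\<^sub>i > 1\<close>.\<close>

lemma (in group) involution_eq_inv:
  assumes "t \<in> carrier G" "t \<otimes> t = \<one>"
  shows "inv t = t"
  using assms by (simp add: inv_equality)

lemma (in group) conj_involution_mult:
  assumes "t \<in> carrier G" "t \<otimes> t = \<one>" "x \<in> carrier G" "y \<in> carrier G"
  shows "t \<otimes> (x \<otimes> y) \<otimes> t = (t \<otimes> x \<otimes> t) \<otimes> (t \<otimes> y \<otimes> t)"
proof -
  have "(t \<otimes> x \<otimes> t) \<otimes> (t \<otimes> y \<otimes> t) = t \<otimes> x \<otimes> (t \<otimes> t) \<otimes> y \<otimes> t"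
    using assms(1,3,4) by (simp add: m_assoc)
  also have "\<dots> = t \<otimes> (x \<otimes> y) \<otimes> t"
    using assms by (simp add: m_assoc)
  finally show ?thesis by simp
qed

lemma (in group) conj_involution_twice:
  assumes "t \<in> carrier G" "t \<otimes> t = \<one>" "x \<in> carrier G"
  shows "t \<otimes> (t \<otimes> x \<otimes> t) \<otimes> t = x"
proof -
  have "t \<otimes> (t \<otimes> x \<otimes> t) \<otimes> t = (t \<otimes> t) \<otimes> x \<otimes> (t \<otimes> t)"
    using assms(1,3) by (simp add: m_assoc)
  then show ?thesis using assms by simp
qed

lemma (in group) conj_involution_in_auto:
  assumes N: "subgroup N G" and t: "t \<in> carrier G" "t \<otimes> t = \<one>"
    and normalizes: "\<And>n. n \<in> N \<Longrightarrow> t \<otimes> n \<otimes> t \<in> N"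
  shows "(\<lambda>n\<in>N. t \<otimes> n \<otimes> t) \<in> auto (G\<lparr>carrier := N\<rparr>)"
proof -
  have NG: "n \<in> carrier G" if "n \<in> N" for n
    using subgroup.mem_carrier[OF N that] .
  have "bij_betw (\<lambda>n\<in>N. t \<otimes> n \<otimes> t) N N"
    by (rule bij_betw_byWitness[where f' = "\<lambda>n\<in>N. t \<otimes> n \<otimes> t"])
       (auto simp: normalizes conj_involution_twice t NG)
  moreover have "(\<lambda>n\<in>N. t \<otimes> n \<otimes> t) \<in> hom (G\<lparr>carrier := N\<rparr>) (G\<lparr>carrier := N\<rparr>)"
    by (rule homI) (auto simp: normalizes subgroup.m_closed[OF N] conj_involution_mult t NG)
  ultimately show ?thesis
    by (simp add: auto_def Bij_def)
qed

text \<open>Conjugation by \<open>t\<close> is multiplicative and commutes with inversion, so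
  stability has to be tested on generators only. This turns the relations between
  \<open>\<tau>\<close> and the simple reflections into normalization of all of
  \<open>W'\<close>.\<close>

lemma (in group) conj_involution_generate:
  assumes S: "S \<subseteq> carrier G" and t: "t \<in> carrier G" "t \<otimes> t = \<one>"
    and normalizes: "\<And>s. s \<in> S \<Longrightarrow> t \<otimes> s \<otimes> t \<in> S"
    and n: "n \<in> generate G S"
  shows "t \<otimes> n \<otimes> t \<in> generate G S"
  using n
proof induction
  case one
  then show ?case using t by (simp add: generate.one)
next
  case (incl h)
  then show ?case using normalizes by (simp add: generate.incl)
next
  case (inv h)
  have "t \<otimes> inv h \<otimes> t = inv (t \<otimes> h \<otimes> t)"
    using inv S t by (simp add: inv_mult_group involution_eq_inv m_assoc subset_iff)
  then show ?case using normalizes[OF inv] by (simp add: generate.inv)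
next
  case (eng h1 h2)
  then have "h1 \<in> carrier G" "h2 \<in> carrier G"
    using generate_in_carrier[OF S] by auto
  then show ?case using eng t by (simp add: conj_involution_mult generate.eng)
qed

text \<open>Moving every \<open>t\<close> to the right by \<open>t n = (t n t) t\<close> reduces
  each word to \<open>n\<close> or \<open>n t\<close>, because \<open>t\<close> squares to one. The
  union of the two cosets is therefore closed under products.\<close>

lemma (in group) generate_insert_involution:
  assumes S: "S \<subseteq> carrier G" and t: "t \<in> carrier G" "t \<otimes> t = \<one>"
    and normalizes: "\<And>s. s \<in> S \<Longrightarrow> t \<otimes> s \<otimes> t \<in> S"
  shows "generate G (insert t S) = generate G S \<union> (\<lambda>n. n \<otimes> t) ` generate G S"
proof
  let ?N = "generate G S"
  have NG: "n \<in> carrier G" if "n \<in> ?N" for n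
    using generate_in_carrier[OF S that] .
  have conj: "t \<otimes> n \<otimes> t \<in> ?N" if "n \<in> ?N" for n
    using conj_involution_generate[OF S t normalizes that] .
  have swap: "m \<otimes> t \<otimes> n = m \<otimes> (t \<otimes> n \<otimes> t) \<otimes> t" if "m \<in> ?N" "n \<in> ?N" for m n
    using NG[OF that(1)] NG[OF that(2)] t by (simp add: m_assoc)
  have cancel: "m \<otimes> t \<otimes> t = m" if "m \<in> ?N" for m
    using NG[OF that] t by (simp add: m_assoc)
  have "x \<in> ?N \<union> (\<lambda>n. n \<otimes> t) ` ?N" if "x \<in> generate G (insert t S)" for x
    using that
  proof induction
    case one
    then show ?case by (simp add: generate.one)
  next
    case (incl h)
    have "t \<in> (\<lambda>n. n \<otimes> t) ` ?N"
      using t generate.one[of G S] by force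
    then show ?case using incl by (auto intro: generate.incl)
  next
    case (inv h)
    have "t \<in> (\<lambda>n. n \<otimes> t) ` ?N"
      using t generate.one[of G S] by force
    then show ?case using inv involution_eq_inv[OF t] by (auto intro: generate.inv)
  next
    case (eng x y)
    then obtain m n where mn: "m \<in> ?N" "n \<in> ?N" "x = m \<or> x = m \<otimes> t" "y = n \<or> y = n \<otimes> t"
      by blast
    have prod: "m \<otimes> n \<in> ?N" "m \<otimes> (t \<otimes> n \<otimes> t) \<in> ?N"
      using mn conj by (auto intro: generate.eng)
    have carr: "m \<in> carrier G" "n \<in> carrier G" "m \<otimes> t \<in> carrier G"
      using mn NG t by auto
    have "m \<otimes> (n \<otimes> t) = (m \<otimes> n) \<otimes> t"
      using carr t by (simp add: m_assoc)
    moreover have "(m \<otimes> t) \<otimes> (n \<otimes> t) = m \<otimes> (t \<otimes> n \<otimes> t)"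
      using carr t by (simp add: m_assoc)
    ultimately show ?case
      using mn(3,4) prod swap[OF mn(1,2)] by auto
  qed
  then show "generate G (insert t S) \<subseteq> ?N \<union> (\<lambda>n. n \<otimes> t) ` ?N" by blast
  have "?N \<subseteq> generate G (insert t S)"
    by (rule mono_generate) blast
  then show "?N \<union> (\<lambda>n. n \<otimes> t) ` ?N \<subseteq> generate G (insert t S)"
    using generate.incl[of t "insert t S" G] by (auto intro: generate.eng)
qed

text \<open>For \<open>e\<close> in {0, 1} the element \<open>t [^] e\<close> is its own inverse, so
  the formula is conjugation although no inverse is written. Restricting to \<open>N\<close> makes
  the maps extensional, as membership in \<open>AutoGroup\<close> requires.\<close>

lemma (in group) involution_semidirect_hom:
  assumes N: "subgroup N G" and t: "t \<in> carrier G" "t \<otimes> t = \<one>"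
    and normalizes: "\<And>n. n \<in> N \<Longrightarrow> t \<otimes> n \<otimes> t \<in> N"
  shows "(\<lambda>e::int. \<lambda>n\<in>N. t [^] e \<otimes> n \<otimes> t [^] e) \<in>
    hom (integer_mod_group 2) (AutoGroup (G\<lparr>carrier := N\<rparr>))"
proof -
  let ?\<theta> = "\<lambda>e::int. \<lambda>n\<in>N. t [^] e \<otimes> n \<otimes> t [^] e"
  have NG: "n \<in> carrier G" if "n \<in> N" for n
    using subgroup.mem_carrier[OF N that] .
  have cases: "e = 0 \<or> e = 1" if "e \<in> carrier (integer_mod_group 2)" for e
    using that by (auto simp: carrier_integer_mod_group)
  have auto0: "?\<theta> 0 \<in> auto (G\<lparr>carrier := N\<rparr>)"
    using conj_involution_in_auto[OF N one_closed] NG by simp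
  have auto1: "?\<theta> 1 \<in> auto (G\<lparr>carrier := N\<rparr>)"
    using conj_involution_in_auto[OF N t normalizes] t by simp
  show ?thesis
  proof (rule homI)
    fix e assume "e \<in> carrier (integer_mod_group 2)"
    then show "?\<theta> e \<in> carrier (AutoGroup (G\<lparr>carrier := N\<rparr>))"
      using auto0 auto1 by (auto simp: AutoGroup_def dest!: cases)
  next
    fix e e' assume e: "e \<in> carrier (integer_mod_group 2)" "e' \<in> carrier (integer_mod_group 2)"
    have Bij: "?\<theta> 0 \<in> Bij N" "?\<theta> 1 \<in> Bij N"
      using auto0 auto1 by (auto simp: auto_def)
    \<comment> \<open>Exponents are added modulo 2; in the case \<open>e = e' = 1\<close>, which
      wraps around to 0, the two conjugations cancel.\<close>
    have "compose N (?\<theta> e) (?\<theta> e') = ?\<theta> ((e + e') mod 2)"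
      using cases[OF e(1)] cases[OF e(2)]
      by (auto simp: compose_def fun_eq_iff NG t normalizes conj_involution_twice)
    moreover have "?\<theta> e \<otimes>\<^bsub>AutoGroup (G\<lparr>carrier := N\<rparr>)\<^esub> ?\<theta> e' = compose N (?\<theta> e) (?\<theta> e')"
      using cases[OF e(1)] cases[OF e(2)] Bij by (auto simp: AutoGroup_def BijGroup_def)
    ultimately show "?\<theta> (e \<otimes>\<^bsub>integer_mod_group 2\<^esub> e') =
        ?\<theta> e \<otimes>\<^bsub>AutoGroup (G\<lparr>carrier := N\<rparr>)\<^esub> ?\<theta> e'"
      by simp
  qed
qed

text \<open>Multiplicativity is the identity
  \<open>(m t^e) (n t^e') = m (t^e n t^e) t^(e + e')\<close>. The hypothesis
  \<open>t \<notin> N\<close> serves injectivity: it keeps the cosets \<open>N\<close> and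
  \<open>N t\<close> disjoint.\<close>

lemma (in group) involution_semidirect_iso:
  assumes N: "subgroup N G" and t: "t \<in> carrier G" "t \<otimes> t = \<one>" "t \<notin> N"
    and normalizes: "\<And>n. n \<in> N \<Longrightarrow> t \<otimes> n \<otimes> t \<in> N"
  shows "(\<lambda>(n, e). n \<otimes> t [^] e) \<in>
    iso (semidirect_product (G\<lparr>carrier := N\<rparr>) (integer_mod_group 2)
          (\<lambda>e::int. \<lambda>n\<in>N. t [^] e \<otimes> n \<otimes> t [^] e))
        (G\<lparr>carrier := N \<union> (\<lambda>n. n \<otimes> t) ` N\<rparr>)" (is "?f \<in> iso ?S ?H")
proof (rule isoI)
  have NG: "n \<in> carrier G" if "n \<in> N" for n
    using subgroup.mem_carrier[OF N that] .
  have carr: "carrier ?S = N \<times> {0, 1}"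
    by (auto simp: semidirect_product_def carrier_integer_mod_group)
  show "?f \<in> hom ?S ?H"
  proof (rule homI)
    fix x assume "x \<in> carrier ?S"
    then show "?f x \<in> carrier ?H"
      unfolding carr using NG t by auto
  next
    fix x y assume "x \<in> carrier ?S" "y \<in> carrier ?S"
    then obtain m e n e' where xy: "x = (m, e)" "y = (n, e')" "m \<in> N" "n \<in> N"
      "e = 0 \<or> e = 1" "e' = 0 \<or> e' = 1"
      unfolding carr by auto
    then show "?f (x \<otimes>\<^bsub>?S\<^esub> y) = ?f x \<otimes>\<^bsub>?H\<^esub> ?f y"
      using NG[OF xy(3)] NG[OF xy(4)] t(1,2)
      by (auto simp: semidirect_product_def m_assoc)
  qed
  have "inj_on ?f (N \<times> {0, 1})"
  proof (rule inj_onI)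
    fix x y assume "x \<in> N \<times> {0, 1}" "y \<in> N \<times> {0, 1}" and eq: "?f x = ?f y"
    then obtain m e n e' where xy: "x = (m, e)" "y = (n, e')" "m \<in> N" "n \<in> N"
      "e = 0 \<or> e = 1" "e' = 0 \<or> e' = 1"
      by auto
    have no: "a \<noteq> b \<otimes> t" if "a \<in> N" "b \<in> N" for a b
    proof
      assume "a = b \<otimes> t"
      then have "t = inv b \<otimes> a" using that NG t by (simp add: inv_solve_left)
      then show False
        using that t(3) subgroup.m_closed[OF N] subgroup.m_inv_closed[OF N] by auto
    qed
    show "x = y"
      using xy(5,6) eq xy(1-4) no[OF xy(3,4)] no[OF xy(4,3)] NG[OF xy(3)] NG[OF xy(4)] t(1)
      by auto
  qed
  moreover have "?f ` (N \<times> {0, 1}) = N \<union> (\<lambda>n. n \<otimes> t) ` N"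
  proof
    show "?f ` (N \<times> {0, 1}) \<subseteq> N \<union> (\<lambda>n. n \<otimes> t) ` N"
      using NG t by auto
    have "n \<in> ?f ` (N \<times> {0, 1})" "n \<otimes> t \<in> ?f ` (N \<times> {0, 1})" if "n \<in> N" for n
      using that NG t image_eqI[of n ?f "(n, 0)" "N \<times> {0, 1}"]
        image_eqI[of "n \<otimes> t" ?f "(n, 1)" "N \<times> {0, 1}"] by auto
    then show "N \<union> (\<lambda>n. n \<otimes> t) ` N \<subseteq> ?f ` (N \<times> {0, 1})" by blast
  qed
  ultimately show "bij_betw ?f (carrier ?S) (carrier ?H)"
    unfolding carr by (simp add: bij_betw_def)
qed


section \<open>Linear functionals, linear maps on the dual space, and its general linear
  group\<close>

lemma dual_space_iff:
  "f \<in> dual_space sc \<longleftrightarrow> vector_space sc \<and> (\<forall>x y. f (x + y) = f x + f y) \<and> (\<forall>c x. f (sc c x) = c * f x)"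
proof -
  have "vector_space ((*) :: complex \<Rightarrow> complex \<Rightarrow> complex)"
    by unfold_locales (auto simp: algebra_simps)
  then show ?thesis
    by (auto simp: dual_space_def Vector_Spaces.linear_iff)
qed

lemma dual_space_scale: "f \<in> dual_space sc \<Longrightarrow> (\<lambda>x. c * f x) \<in> dual_space sc"
  by (auto simp: dual_space_iff algebra_simps)

lemma dual_space_add:
  "f \<in> dual_space sc \<Longrightarrow> g \<in> dual_space sc \<Longrightarrow> (\<lambda>x. f x + g x) \<in> dual_space sc"
  by (auto simp: dual_space_iff algebra_simps)

lemma dual_space_diff_scale:
  "f \<in> dual_space sc \<Longrightarrow> g \<in> dual_space sc \<Longrightarrow> (\<lambda>x. f x - c * g x) \<in> dual_space sc"
  by (auto simp: dual_space_iff algebra_simps)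

lemma linear_on_dual_add:
  "linear_on_dual sc T \<Longrightarrow> f \<in> dual_space sc \<Longrightarrow> g \<in> dual_space sc \<Longrightarrow>
    T (\<lambda>x. f x + g x) = (\<lambda>y. T f y + T g y)"
  by (simp add: linear_on_dual_def)

lemma linear_on_dual_scale:
  "linear_on_dual sc T \<Longrightarrow> f \<in> dual_space sc \<Longrightarrow> T (\<lambda>x. c * f x) = (\<lambda>y. c * T f y)"
  by (simp add: linear_on_dual_def)

lemma linear_on_dual_diff_scale:
  assumes "linear_on_dual sc T" "f \<in> dual_space sc" "g \<in> dual_space sc"
  shows "T (\<lambda>x. f x - c * g x) = (\<lambda>y. T f y - c * T g y)"
  using linear_on_dual_add[OF assms(1,2) dual_space_scale[OF assms(3), of "- c"]]
    linear_on_dual_scale[OF assms(1,3), of "- c"] by simp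

text \<open>Sums and multiples of functionals are functionals, so \<open>linear_on_dual\<close>
  evaluates its map only there. Hence linearity survives the passage to the extensional maps that
  \<open>GL_dual\<close> consists of.\<close>

lemma linear_on_dual_restrict:
  "linear_on_dual sc (restrict T (dual_space sc)) \<longleftrightarrow> linear_on_dual sc T"
  by (simp add: linear_on_dual_def dual_space_add dual_space_scale)

lemma linear_on_dual_comp:
  assumes "linear_on_dual sc T" "linear_on_dual sc' U"
    and "\<And>f. f \<in> dual_space sc \<Longrightarrow> T f \<in> dual_space sc'"
  shows "linear_on_dual sc (\<lambda>f. U (T f))"
  using assms by (simp add: linear_on_dual_def)

lemma linear_on_dual_inv_into:
  assumes T: "linear_on_dual sc T" and bij: "bij_betw T (dual_space sc) (dual_space sc')"
  shows "linear_on_dual sc' (inv_into (dual_space sc) T)"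
proof -
  let ?V = "dual_space sc" and ?S = "inv_into (dual_space sc) T"
  have SV: "?S f \<in> ?V" and TS: "T (?S f) = f" if "f \<in> dual_space sc'" for f
    using that bij by (auto simp: bij_betw_def inv_into_into f_inv_into_f)
  have inj: "inj_on T ?V" using bij by (simp add: bij_betw_def)
  show ?thesis
    unfolding linear_on_dual_def
  proof (intro conjI ballI allI)
    fix f g assume f: "f \<in> dual_space sc'" and g: "g \<in> dual_space sc'"
    have "T (\<lambda>x. ?S f x + ?S g x) = (\<lambda>x. f x + g x)"
      using linear_on_dual_add[OF T SV[OF f] SV[OF g]] by (simp add: TS f g)
    then show "?S (\<lambda>x. f x + g x) = (\<lambda>y. ?S f y + ?S g y)"
      using inv_into_f_f[OF inj dual_space_add[OF SV[OF f] SV[OF g]]] by simp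
  next
    fix c f assume f: "f \<in> dual_space sc'"
    have "T (\<lambda>x. c * ?S f x) = (\<lambda>x. c * f x)"
      using linear_on_dual_scale[OF T SV[OF f]] by (simp add: TS f)
    then show "?S (\<lambda>x. c * f x) = (\<lambda>y. c * ?S f y)"
      using inv_into_f_f[OF inj dual_space_scale[OF SV[OF f]]] by metis
  qed
qed

lemma carrier_GL_dual:
  "T \<in> carrier (GL_dual sc) \<longleftrightarrow>
    T \<in> extensional (dual_space sc) \<and> bij_betw T (dual_space sc) (dual_space sc) \<and> linear_on_dual sc T"
  by (auto simp: GL_dual_def Bij_def)

lemma one_GL_dual: "\<one>\<^bsub>GL_dual sc\<^esub> = (\<lambda>f\<in>dual_space sc. f)"
  by (simp add: GL_dual_def BijGroup_def)

lemma mult_GL_dual: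
  "T \<in> carrier (GL_dual sc) \<Longrightarrow> U \<in> carrier (GL_dual sc) \<Longrightarrow>
    T \<otimes>\<^bsub>GL_dual sc\<^esub> U = (\<lambda>f\<in>dual_space sc. T (U f))"
  by (simp add: GL_dual_def BijGroup_def compose_def)

lemma mult_GL_dual_apply:
  "T \<in> carrier (GL_dual sc) \<Longrightarrow> U \<in> carrier (GL_dual sc) \<Longrightarrow> f \<in> dual_space sc \<Longrightarrow>
    (T \<otimes>\<^bsub>GL_dual sc\<^esub> U) f = T (U f)"
  by (simp add: mult_GL_dual)

lemma GL_dual_closed: "T \<in> carrier (GL_dual sc) \<Longrightarrow> f \<in> dual_space sc \<Longrightarrow> T f \<in> dual_space sc"
  by (auto simp: carrier_GL_dual bij_betw_def)

lemma GL_dual_eqI: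
  "T \<in> carrier (GL_dual sc) \<Longrightarrow> U \<in> carrier (GL_dual sc) \<Longrightarrow>
    (\<And>f. f \<in> dual_space sc \<Longrightarrow> T f = U f) \<Longrightarrow> T = U"
  by (auto simp: carrier_GL_dual intro: extensionalityI)

lemma group_GL_dual: "group (GL_dual sc)"
proof -
  let ?V = "dual_space sc" and ?L = "{T \<in> Bij (dual_space sc). linear_on_dual sc T}"
  have "subgroup ?L (BijGroup ?V)"
  proof (rule subgroup.intro)
    show "?L \<subseteq> carrier (BijGroup ?V)"
      by (auto simp: BijGroup_def)
    show "\<one>\<^bsub>BijGroup ?V\<^esub> \<in> ?L"
      using linear_on_dual_restrict[of sc "\<lambda>f. f"]
      by (simp add: BijGroup_def id_Bij) (simp add: linear_on_dual_def)
  next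
    fix T U assume TU: "T \<in> ?L" "U \<in> ?L"
    then have "linear_on_dual sc (\<lambda>f. T (U f))"
      by (intro linear_on_dual_comp[of sc U sc T]) (auto dest: Bij_imp_funcset)
    then show "T \<otimes>\<^bsub>BijGroup ?V\<^esub> U \<in> ?L"
      using TU compose_Bij[of T ?V U] by (auto simp: BijGroup_def compose_def linear_on_dual_restrict)
  next
    fix T assume T: "T \<in> ?L"
    then have "linear_on_dual sc (inv_into ?V T)"
      by (intro linear_on_dual_inv_into) (auto simp: Bij_def)
    then show "inv\<^bsub>BijGroup ?V\<^esub> T \<in> ?L"
      using T restrict_inv_into_Bij[of T ?V] by (auto simp: inv_BijGroup linear_on_dual_restrict)
  qed
  then show ?thesis
    unfolding GL_dual_def by (rule subgroup.subgroup_is_group[OF _ group_BijGroup])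
qed

section \<open>Conjugation by a linear isomorphism between dual spaces\<close>

lemma transport_closed:
  assumes bij: "bij_betw \<phi> (dual_space sc) (dual_space sc')" and lin: "linear_on_dual sc \<phi>"
    and w: "w \<in> carrier (GL_dual sc)"
  shows "transport sc sc' \<phi> w \<in> carrier (GL_dual sc')"
proof -
  let ?V = "dual_space sc" and ?S = "inv_into (dual_space sc) \<phi>"
  have bijS: "bij_betw ?S (dual_space sc') ?V"
    using bij by (rule bij_betw_inv_into)
  have bijw: "bij_betw w ?V ?V" and linw: "linear_on_dual sc w"
    using w by (auto simp: carrier_GL_dual)
  have "bij_betw (\<phi> \<circ> (w \<circ> ?S)) (dual_space sc') (dual_space sc')"
    using bijS bijw bij by (intro bij_betw_trans)
  moreover have "linear_on_dual sc' (\<lambda>f. w (?S f))"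
    using bijS by (intro linear_on_dual_comp[OF linear_on_dual_inv_into[OF lin bij] linw])
      (auto simp: bij_betw_def)
  then have "linear_on_dual sc' (\<lambda>f. \<phi> (w (?S f)))"
    using bijS bijw by (intro linear_on_dual_comp[OF _ lin]) (auto simp: bij_betw_def)
  ultimately show ?thesis
    by (simp add: carrier_GL_dual transport_def linear_on_dual_restrict comp_def)
qed

lemma transport_apply:
  assumes "bij_betw \<phi> (dual_space sc) (dual_space sc')" "f \<in> dual_space sc"
  shows "transport sc sc' \<phi> w (\<phi> f) = \<phi> (w f)"
  using assms by (auto simp: transport_def bij_betw_def inv_into_f_f)

lemma transport_hom:
  assumes bij: "bij_betw \<phi> (dual_space sc) (dual_space sc')" and lin: "linear_on_dual sc \<phi>"
  shows "transport sc sc' \<phi> \<in> hom (GL_dual sc) (GL_dual sc')"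
proof (rule homI)
  fix w assume "w \<in> carrier (GL_dual sc)"
  then show "transport sc sc' \<phi> w \<in> carrier (GL_dual sc')"
    by (rule transport_closed[OF bij lin])
next
  fix w u assume w: "w \<in> carrier (GL_dual sc)" and u: "u \<in> carrier (GL_dual sc)"
  interpret G: group "GL_dual sc" by (rule group_GL_dual)
  interpret G': group "GL_dual sc'" by (rule group_GL_dual)
  note tr = transport_closed[OF bij lin]
  show "transport sc sc' \<phi> (w \<otimes>\<^bsub>GL_dual sc\<^esub> u) =
      transport sc sc' \<phi> w \<otimes>\<^bsub>GL_dual sc'\<^esub> transport sc sc' \<phi> u"
  proof (rule GL_dual_eqI)
    fix f assume "f \<in> dual_space sc'"
    \<comment> \<open>On an element written as \<open>\<phi> g\<close> the transported map acts by
      \<open>\<phi> g \<mapsto> \<phi> (w g)\<close>, which removes the inverse of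
      \<open>\<phi>\<close> from the computation.\<close>
    then obtain g where g: "g \<in> dual_space sc" "f = \<phi> g"
      using bij by (auto simp: bij_betw_def)
    then show "transport sc sc' \<phi> (w \<otimes>\<^bsub>GL_dual sc\<^esub> u) f =
      (transport sc sc' \<phi> w \<otimes>\<^bsub>GL_dual sc'\<^esub> transport sc sc' \<phi> u) f"
      using w u \<open>f \<in> dual_space sc'\<close>
      by (simp add: mult_GL_dual tr transport_apply[OF bij] GL_dual_closed)
  qed (use w u tr in auto)
qed

lemma transport_inj:
  assumes bij: "bij_betw \<phi> (dual_space sc) (dual_space sc')"
  shows "inj_on (transport sc sc' \<phi>) (carrier (GL_dual sc))"
proof (rule inj_onI)
  fix w u assume w: "w \<in> carrier (GL_dual sc)" and u: "u \<in> carrier (GL_dual sc)"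
    and eq: "transport sc sc' \<phi> w = transport sc sc' \<phi> u"
  show "w = u"
  proof (rule GL_dual_eqI[OF w u])
    fix f assume f: "f \<in> dual_space sc"
    have "\<phi> (w f) = \<phi> (u f)"
      using transport_apply[OF bij f, of w] transport_apply[OF bij f, of u] eq by simp
    then show "w f = u f"
      using bij GL_dual_closed[OF w f] GL_dual_closed[OF u f] by (auto simp: bij_betw_def inj_on_def)
  qed
qed

section \<open>Simple reflections, the Weyl group and the invariant form\<close>

lemma simple_reflection_apply:
  "f \<in> dual_space sc \<Longrightarrow> simple_reflection sc \<alpha> \<alpha>v k f = (\<lambda>x. f x - f (\<alpha>v k) * \<alpha> k x)"
  by (simp add: simple_reflection_def)

lemma simple_reflection_closed:
  "\<alpha> k \<in> dual_space sc \<Longrightarrow> f \<in> dual_space sc \<Longrightarrow> simple_reflection sc \<alpha> \<alpha>v k f \<in> dual_space sc"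
  by (simp add: simple_reflection_apply dual_space_diff_scale)

lemma simple_reflection_twice:
  assumes "\<alpha> k \<in> dual_space sc" "\<alpha> k (\<alpha>v k) = 2" "f \<in> dual_space sc"
  shows "simple_reflection sc \<alpha> \<alpha>v k (simple_reflection sc \<alpha> \<alpha>v k f) = f"
  using assms(2)
  by (subst simple_reflection_apply[of _ sc], simp add: assms simple_reflection_closed)
    (simp add: simple_reflection_apply assms(3) algebra_simps)

lemma simple_reflection_GL:
  assumes \<alpha>: "\<alpha> k \<in> dual_space sc" "\<alpha> k (\<alpha>v k) = 2"
  shows "simple_reflection sc \<alpha> \<alpha>v k \<in> carrier (GL_dual sc)"
proof -
  let ?s = "simple_reflection sc \<alpha> \<alpha>v k"
  have "bij_betw ?s (dual_space sc) (dual_space sc)"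
    by (rule bij_betw_byWitness[where f' = ?s])
       (use \<alpha> in \<open>auto simp: simple_reflection_twice simple_reflection_closed\<close>)
  moreover have "linear_on_dual sc ?s"
    using \<alpha>
    by (auto simp: linear_on_dual_def simple_reflection_apply dual_space_add dual_space_scale algebra_simps)
  moreover have "?s \<in> extensional (dual_space sc)"
    by (simp add: simple_reflection_def)
  ultimately show ?thesis by (simp add: carrier_GL_dual)
qed

lemma simple_reflection_involution:
  assumes \<alpha>: "\<alpha> k \<in> dual_space sc" "\<alpha> k (\<alpha>v k) = 2"
  shows "simple_reflection sc \<alpha> \<alpha>v k \<otimes>\<^bsub>GL_dual sc\<^esub> simple_reflection sc \<alpha> \<alpha>v k = \<one>\<^bsub>GL_dual sc\<^esub>"
  using assms
  by (simp add: mult_GL_dual simple_reflection_GL simple_reflection_twice one_GL_dual cong: restrict_cong)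

text \<open>\<open>subgroup_generated\<close> first intersects the generators with the carrier. The
  reflections all lie in it, so the intersection changes nothing and induction over
  \<open>generate\<close> becomes available.\<close>

lemma weyl_group_eq:
  assumes "\<And>k. \<alpha> k \<in> dual_space sc" "\<And>k. \<alpha> k (\<alpha>v k) = 2"
  shows "weyl_group sc \<alpha> \<alpha>v =
    GL_dual sc\<lparr>carrier := generate (GL_dual sc) (range (simple_reflection sc \<alpha> \<alpha>v))\<rparr>"
proof -
  have "range (simple_reflection sc \<alpha> \<alpha>v) \<subseteq> carrier (GL_dual sc)"
    using simple_reflection_GL[of \<alpha> _ sc \<alpha>v, OF assms] by blast
  then show ?thesis
    by (simp add: weyl_group_def subgroup_generated_def Int_absorb1)
qed

text \<open>Take invariance at the single reflection \<open>s\<close> in \<open>\<alpha> k\<close>.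
  It negates \<open>\<alpha> k\<close> and sends \<open>f\<close> to
  \<open>f - f (\<alpha>v k) \<alpha> k\<close>, so
  \<open>B (s f) (s (\<alpha> k)) = B f (\<alpha> k)\<close> becomes
  \<open>2 d_k f (\<alpha>v k) - B (\<alpha> k) f = B (\<alpha> k) f\<close>. The coroots are thus
  expressed by the form, which allows them to be compared across \<open>\<phi>\<close>.\<close>

lemma standard_form_coroot:
  assumes form: "standard_form C d sc \<alpha> \<alpha>v B"
    and \<alpha>: "\<And>k. \<alpha> k \<in> dual_space sc" "\<And>k. \<alpha> k (\<alpha>v k) = 2" and C: "C $ k $ k = 2"
    and f: "f \<in> dual_space sc"
  shows "B (\<alpha> k) f = of_nat (d k) * f (\<alpha>v k)"
proof -
  let ?V = "dual_space sc" and ?s = "simple_reflection sc \<alpha> \<alpha>v k"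
  have add: "B f (\<lambda>x. g x + h x) = B f g + B f h"
    and scale: "B f (\<lambda>x. c * g x) = c * B f g"
    and sym: "B f g = B g f" if "f \<in> ?V" "g \<in> ?V" "h \<in> ?V" for f g h c
    using form that unfolding standard_form_def by blast+
  have "?s \<in> carrier (weyl_group sc \<alpha> \<alpha>v)"
    by (simp add: weyl_group_eq[OF \<alpha>] generate.incl)
  then have "B (?s f) (?s (\<alpha> k)) = B f (\<alpha> k)"
    using form f \<alpha>(1) unfolding standard_form_def by blast
  moreover have "?s (\<alpha> k) = (\<lambda>x. (-1) * \<alpha> k x)"
    by (simp add: simple_reflection_apply \<alpha>)
  moreover have "?s f = (\<lambda>x. f x + (- f (\<alpha>v k)) * \<alpha> k x)"
    by (simp add: simple_reflection_apply f)
  moreover have "?s f \<in> ?V"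
    by (rule simple_reflection_closed[OF \<alpha>(1) f])
  moreover have "B (\<alpha> k) (\<alpha> k) = 2 * of_nat (d k)"
    using form C by (simp add: standard_form_def)
  moreover have "B (?s f) (\<lambda>x. (-1) * \<alpha> k x) = (-1) * B (\<alpha> k) (?s f)"
    using scale[of "?s f" "\<alpha> k" "\<alpha> k" "-1"] sym[of "?s f" "\<alpha> k" "\<alpha> k"] \<open>?s f \<in> ?V\<close> \<alpha>(1) by simp
  moreover have "B (\<alpha> k) (\<lambda>x. f x + (- f (\<alpha>v k)) * \<alpha> k x) = B (\<alpha> k) f + (- f (\<alpha>v k)) * B (\<alpha> k) (\<alpha> k)"
    using add[OF \<alpha>(1)[of k] f dual_space_scale[OF \<alpha>(1)[of k], of "- f (\<alpha>v k)"]]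
      scale[OF \<alpha>(1)[of k] \<alpha>(1)[of k] f, of "- f (\<alpha>v k)"] by (simp only:)
  moreover have "B f (\<alpha> k) = B (\<alpha> k) f"
    using sym f \<alpha>(1) by blast
  ultimately have "- (B (\<alpha> k) f - f (\<alpha>v k) * (2 * of_nat (d k))) = B (\<alpha> k) f"
    by simp
  then show ?thesis by (simp add: field_simps)
qed

section \<open>Integral weights and translation by the root lattice\<close>

lemma (in vector_space) independent_family:
  fixes b :: "'v::finite \<Rightarrow> 'b"
  assumes "\<And>c. (\<Sum>k\<in>UNIV. scale (c k) (b k)) = 0 \<Longrightarrow> \<forall>k. c k = 0"
  shows "inj b" and "independent (range b)"
proof -
  show inj: "inj b"
  proof (rule injI, rule ccontr)
    fix k l assume eq: "b k = b l" and "k \<noteq> l"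
    \<comment> \<open>If two members of the family coincided, the coefficients 1 and -1 at their
      indices would give a nontrivial relation.\<close>
    let ?c = "\<lambda>m. if m = k then 1 else if m = l then -1 else (0 :: 'a)"
    have "(\<Sum>m\<in>UNIV. scale (?c m) (b m)) = (\<Sum>m\<in>{k, l}. scale (?c m) (b m))"
      by (rule sum.mono_neutral_right) auto
    also have "\<dots> = 0" using eq \<open>k \<noteq> l\<close> by simp
    finally have "\<forall>k. ?c k = 0" by (rule assms)
    then show False by (metis zero_neq_one)
  qed
  show "independent (range b)"
  proof (rule independent_if_scalars_zero)
    fix f x assume sum: "(\<Sum>x\<in>range b. scale (f x) x) = 0" and "x \<in> range b"
    then obtain k where "x = b k" by blast
    moreover have "(\<Sum>k\<in>UNIV. scale (f (b k)) (b k)) = 0"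
      using sum by (simp add: sum.reindex[OF inj])
    ultimately show "f x = 0" using assms[of "\<lambda>k. f (b k)"] by simp
  qed simp
qed

text \<open>The coroots are linearly independent, so values prescribed on them extend to a
  functional on the whole space. This supplies fundamental weights.\<close>

lemma cartan_realization_functional:
  assumes "cartan_realization C sc \<alpha> \<alpha>v"
  obtains f where "f \<in> dual_space sc" "\<And>k. f (\<alpha>v k) = c k"
proof -
  \<comment> \<open>Membership of a simple root in \<open>dual_space sc\<close> already contains
    this.\<close>
  have "vector_space sc"
    using assms by (auto simp: cartan_realization_def dual_space_iff)
  then interpret vector_space_pair sc "(*) :: complex \<Rightarrow> complex \<Rightarrow> complex"
    by (auto simp: vector_space_pair_def) (unfold_locales, auto simp: algebra_simps)
  have indep: "\<And>c. (\<Sum>k\<in>UNIV. sc (c k) (\<alpha>v k)) = 0 \<Longrightarrow> \<forall>k. c k = 0"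
    using assms by (auto simp: cartan_realization_def)
  obtain f where f: "Vector_Spaces.linear sc (*) f" "\<forall>x\<in>range \<alpha>v. f x = c (inv_into UNIV \<alpha>v x)"
    using linear_independent_extend[OF vs1.independent_family(2)[OF indep],
      where f = "\<lambda>x. c (inv_into UNIV \<alpha>v x)"] by blast
  then have "f (\<alpha>v k) = c k" for k
    by (simp add: vs1.independent_family(1)[OF indep])
  then show ?thesis using f(1) that by (simp add: dual_space_def)
qed

text \<open>A reflection subtracts \<open>f (\<alpha>v k)\<close> times \<open>\<alpha> k\<close>.
  For \<open>f\<close> in the coset of \<open>g\<close> modulo the root lattice this coefficient is
  an integer, since \<open>g\<close> and all simple roots are integral on the coroots. So every
  generator maps the coset \<open>L\<close> to itself.\<close>

lemma weyl_group_root_lattice: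
  assumes \<alpha>: "\<And>k. \<alpha> k \<in> dual_space sc" "\<And>k. \<alpha> k (\<alpha>v k) = 2"
    and int: "\<And>k l. \<alpha> l (\<alpha>v k) \<in> \<int>"
    and w: "w \<in> carrier (weyl_group sc \<alpha> \<alpha>v)"
    and g: "g \<in> dual_space sc" "\<And>k. g (\<alpha>v k) \<in> \<int>"
  obtains v where "w g = (\<lambda>x. g x + root_comb \<alpha> v x)"
proof -
  interpret G: group "GL_dual sc" by (rule group_GL_dual)
  define L where "L = {f \<in> dual_space sc. \<exists>v. f = (\<lambda>x. g x + root_comb \<alpha> v x)}"
  have refl: "simple_reflection sc \<alpha> \<alpha>v k f \<in> L" if fL: "f \<in> L" for k f
  proof -
    obtain v where f: "f \<in> dual_space sc" "f = (\<lambda>x. g x + root_comb \<alpha> v x)"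
      using fL unfolding L_def by blast
    have "f (\<alpha>v k) \<in> \<int>"
      using g(2) int by (auto simp: f(2) root_comb_def intro!: Ints_sum Ints_add Ints_mult)
    then obtain m where m: "f (\<alpha>v k) = of_int m" by (auto elim: Ints_cases)
    have "root_comb \<alpha> (\<lambda>l. v l - (if l = k then m else 0)) x = root_comb \<alpha> v x - of_int m * \<alpha> k x" for x
      by (simp add: root_comb_def left_diff_distrib sum_subtractf if_distrib[of of_int]
          if_distrib[of "\<lambda>y. y * _"] cong: if_cong)
    then have "simple_reflection sc \<alpha> \<alpha>v k f = (\<lambda>x. g x + root_comb \<alpha> (\<lambda>l. v l - (if l = k then m else 0)) x)"
      by (simp add: simple_reflection_apply f(1) m) (simp add: f(2) algebra_simps)
    then show ?thesis
      using simple_reflection_closed[of \<alpha> k sc f \<alpha>v, OF \<alpha>(1) f(1)] by (auto simp: L_def)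
  qed
  have S: "range (simple_reflection sc \<alpha> \<alpha>v) \<subseteq> carrier (GL_dual sc)"
    using simple_reflection_GL[of \<alpha> _ sc \<alpha>v, OF \<alpha>] by blast
  have "w \<in> generate (GL_dual sc) (range (simple_reflection sc \<alpha> \<alpha>v))"
    using w by (simp add: weyl_group_eq[OF \<alpha>])
  then have "\<forall>f\<in>L. w f \<in> L"
  proof induction
    case one
    then show ?case by (auto simp: one_GL_dual L_def)
  next
    case (incl h)
    then show ?case using refl by auto
  next
    case (inv h)
    then obtain k where h: "h = simple_reflection sc \<alpha> \<alpha>v k" by auto
    then have "inv\<^bsub>GL_dual sc\<^esub> h = h"
      using G.involution_eq_inv simple_reflection_GL[of \<alpha> _ sc \<alpha>v, OF \<alpha>] simple_reflection_involution[of \<alpha> _ sc \<alpha>v, OF \<alpha>] by metis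
    then show ?case using refl h by auto
  next
    case (eng h1 h2)
    then have "h1 \<otimes>\<^bsub>GL_dual sc\<^esub> h2 = (\<lambda>f\<in>dual_space sc. h1 (h2 f))"
      using G.generate_in_carrier[OF S] by (intro mult_GL_dual) auto
    then show ?case using eng.IH by (auto simp: L_def)
  qed
  moreover have "g \<in> L"
    using g(1) by (auto simp: L_def root_comb_def intro!: exI[of _ "\<lambda>k. 0"])
  ultimately show ?thesis using that by (auto simp: L_def)
qed

section \<open>Entries of the Cartan matrix\<close>

lemma cartan_matrix_nth:
  "cartan_matrix Q d $ k $ l = (if k = l then 2 else 0) - adj_matrix Q $ k $ l * int (d l)"
  by (simp add: cartan_matrix_def matrix_matrix_mult_def mult_matrix_def mat_def
      if_distrib[of "\<lambda>y. _ * y"] cong: if_cong)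

lemma adj_matrix_diag:
  assumes "quiver Q"
  shows "adj_matrix Q $ k $ k = 0"
proof -
  have "{h \<in> arcs Q. {tail Q h, head Q h} = {k, k}} = {}"
    using assms by (auto simp: quiver_def loopfree_digraph_def loopfree_digraph_axioms_def)
  then show ?thesis by (simp only: adj_matrix_def vec_lambda_beta card.empty of_nat_0)
qed

theorem proposition5p13:
  fixes Q :: "('v::finite, 'a) pre_digraph"
    and d :: "'v \<Rightarrow> nat"
    and i j :: 'v
    and sc :: "complex \<Rightarrow> 'h::ab_group_add \<Rightarrow> 'h"
    and \<alpha> :: "'v \<Rightarrow> 'h \<Rightarrow> complex"
    and \<alpha>v :: "'v \<Rightarrow> 'h"
    and form :: "('h \<Rightarrow> complex) \<Rightarrow> ('h \<Rightarrow> complex) \<Rightarrow> complex"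
    and sc' :: "complex \<Rightarrow> 'k::ab_group_add \<Rightarrow> 'k"
    and \<alpha>' :: "'v \<Rightarrow> 'k \<Rightarrow> complex"
    and \<alpha>v' :: "'v \<Rightarrow> 'k"
    and form' :: "('k \<Rightarrow> complex) \<Rightarrow> ('k \<Rightarrow> complex) \<Rightarrow> complex"
    and \<phi> :: "('h \<Rightarrow> complex) \<Rightarrow> ('k \<Rightarrow> complex)"
  defines "C \<equiv> cartan_matrix Q d"
    and "C' \<equiv> cartan_matrix (normalization Q d i j) (normalized_mult d i)"
    and "W \<equiv> weyl_group sc \<alpha> \<alpha>v"
    and "W' \<equiv> weyl_group sc' \<alpha>' \<alpha>v'"
    and "\<sigma> \<equiv> Transposition.transpose i j"
  assumes quiver: "quiver_with_multiplicities Q d"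
    and pole: "irregular_pole_vertex Q d i j"
    and real: "cartan_realization C sc \<alpha> \<alpha>v"
    and real': "cartan_realization C' sc' \<alpha>' \<alpha>v'"
    and form: "standard_form C d sc \<alpha> \<alpha>v form"
    and form': "standard_form C' (normalized_mult d i) sc' \<alpha>' \<alpha>v' form'"
    and \<phi>_bij: "bij_betw \<phi> (dual_space sc) (dual_space sc')"
    and \<phi>_linear: "linear_on_dual sc \<phi>"
    and \<phi>_extends: "\<And>v. \<phi> (root_comb \<alpha> v) = (\<lambda>x. root_comb \<alpha>' v x - of_int (v i) * \<alpha>' j x)"
    and \<phi>_form: "\<And>f g. f \<in> dual_space sc \<Longrightarrow> g \<in> dual_space sc \<Longrightarrow> form' (\<phi> f) (\<phi> g) = form f g"
  shows "\<exists>\<theta> \<Psi> \<tau>.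
      \<theta> \<in> hom (integer_mod_group 2) (AutoGroup W') \<and>
      (\<forall>k. \<theta> 1 (simple_reflection sc' \<alpha>' \<alpha>v' k) = simple_reflection sc' \<alpha>' \<alpha>v' (\<sigma> k)) \<and>
      \<Psi> \<in> iso W (semidirect_product W' (integer_mod_group 2) \<theta>) \<and>
      \<tau> \<in> carrier (GL_dual sc') \<and>
      (\<forall>k. \<tau> (\<alpha>' k) = \<alpha>' (\<sigma> k)) \<and>
      (\<forall>w\<in>carrier W. \<forall>u e. \<Psi> w = (u, e) \<longrightarrow>
         transport sc sc' \<phi> w = u \<otimes>\<^bsub>GL_dual sc'\<^esub> (\<tau> [^]\<^bsub>GL_dual sc'\<^esub> e))"
proof -
  interpret G: group "GL_dual sc" by (rule group_GL_dual)
  interpret G': group "GL_dual sc'" by (rule group_GL_dual)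
  let ?V = "dual_space sc" and ?V' = "dual_space sc'"
  let ?G = "GL_dual sc" and ?G' = "GL_dual sc'"
  let ?s = "simple_reflection sc \<alpha> \<alpha>v" and ?s' = "simple_reflection sc' \<alpha>' \<alpha>v'"
  let ?T = "transport sc sc' \<phi>"

  \<comment> \<open>Numerical data at the pole vertex\<close>
  have Q: "quiver Q" and d: "\<And>k. d k > 0"
    using quiver by (auto simp: quiver_with_multiplicities_def)
  have di: "d i > 1" and dj: "d j = 1"
    and adj: "\<And>k. adj_matrix Q $ i $ k = of_bool (j = k)" "\<And>k. adj_matrix Q $ k $ i = of_bool (j = k)"
    using pole by (auto simp: irregular_pole_vertex_def)
  \<comment> \<open>For \<open>i = j\<close> the pole condition would put a 1 on the diagonal of the
    adjacency matrix, but a quiver has no loops.\<close>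
  have ij: "i \<noteq> j"
    using adj(1)[of i] adj_matrix_diag[OF Q, of i] by auto

  have \<alpha>: "\<alpha> k \<in> ?V" and \<alpha>_C: "\<alpha> l (\<alpha>v k) = of_int (C $ k $ l)" for k l
    using real by (auto simp: cartan_realization_def)
  have \<alpha>': "\<alpha>' k \<in> ?V'" and \<alpha>'_C: "\<alpha>' l (\<alpha>v' k) = of_int (C' $ k $ l)" for k l
    using real' by (auto simp: cartan_realization_def)
  have \<alpha>2: "\<alpha> k (\<alpha>v k) = 2" for k
    by (simp add: \<alpha>_C C_def cartan_matrix_nth adj_matrix_diag[OF Q])
  \<comment> \<open>Row and column \<open>i\<close> of \<open>C\<close> differ: the edge to
    \<open>j\<close> is weighted by \<open>d j = 1\<close> in the row and by \<open>d i\<close> in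
    the column.\<close>
  have \<alpha>_i: "\<alpha> k (\<alpha>v i) = (if k = i then 2 else if k = j then -1 else 0)" for k
    using adj(1)[of k] ij dj by (auto simp: \<alpha>_C C_def cartan_matrix_nth)
  have i_\<alpha>: "\<alpha> i (\<alpha>v k) = (if k = i then 2 else if k = j then - of_nat (d i) else 0)" for k
    using adj(2)[of k] ij by (auto simp: \<alpha>_C C_def cartan_matrix_nth)

  \<comment> \<open>The isomorphism on simple roots\<close>
  have V': "\<phi> f \<in> ?V'" if "f \<in> ?V" for f
    using that \<phi>_bij by (auto simp: bij_betw_def)
  have \<phi>_surj: "\<exists>g\<in>?V. f = \<phi> g" if "f \<in> ?V'" for f
    using that \<phi>_bij by (auto simp: bij_betw_def)
  have unit: "root_comb a (\<lambda>l. if l = k then 1 else 0) = a k" for a :: "'v \<Rightarrow> 'c \<Rightarrow> complex" and k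
    by (simp add: root_comb_def fun_eq_iff if_distrib[of of_int] if_distrib[of "\<lambda>y. y * _"] cong: if_cong)
  have \<phi>_\<alpha>: "\<phi> (\<alpha> k) = \<alpha>' k" if "k \<noteq> i" for k
    using \<phi>_extends[of "\<lambda>l. if l = k then 1 else 0"] that by (auto simp: unit)
  have \<phi>_\<alpha>_i: "\<phi> (\<alpha> i) = (\<lambda>x. \<alpha>' i x - \<alpha>' j x)"
    using \<phi>_extends[of "\<lambda>l. if l = i then 1 else 0"] by (auto simp: unit)
  \<comment> \<open>\<open>\<phi>\<close> sends \<open>\<alpha> i\<close> to
    \<open>\<alpha>' i - \<alpha>' j\<close> and \<open>\<alpha> j\<close> to
    \<open>\<alpha>' j\<close>, so this sum is the preimage of \<open>\<alpha>' i\<close>. Through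
    it, statements about \<open>\<alpha>' i\<close> are computed on the side of
    \<open>C\<close>.\<close>
  define \<beta> where "\<beta> = (\<lambda>x. \<alpha> i x + \<alpha> j x)"
  have \<beta>: "\<beta> \<in> ?V"
    unfolding \<beta>_def by (rule dual_space_add[OF \<alpha> \<alpha>])
  have \<phi>_\<beta>: "\<phi> \<beta> = \<alpha>' i"
    using linear_on_dual_add[OF \<phi>_linear \<alpha>[of i] \<alpha>[of j]] ij
    by (simp add: \<beta>_def \<phi>_\<alpha>_i \<phi>_\<alpha>)

  \<comment> \<open>Comparison of the forms and of the coroots\<close>
  have coroot: "form (\<alpha> k) f = of_nat (d k) * f (\<alpha>v k)" if "f \<in> ?V" for k f
  proof (rule standard_form_coroot[OF form \<alpha> \<alpha>2 _ that])
    show "C $ k $ k = 2"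
      by (simp add: C_def cartan_matrix_nth adj_matrix_diag[OF Q])
  qed
  have form_add: "form f (\<lambda>x. g x + h x) = form f g + form f h"
    and form_sym: "form f g = form g f" if "f \<in> ?V" "g \<in> ?V" "h \<in> ?V" for f g h
    using form that unfolding standard_form_def by blast+
  \<comment> \<open>The diagonal of \<open>C'\<close> is read off from the forms:
    \<open>form' (\<alpha>' k) (\<alpha>' k)\<close> is the positive multiplicity times the entry,
    and \<open>\<phi>\<close> preserves it. For \<open>k = i\<close> it equals
    \<open>form \<beta> \<beta>\<close>, namely \<open>d i + (2 - d i) = 2\<close>.\<close>
  have C'2: "C' $ k $ k = 2" for k
  proof (cases "k = i")
    case False
    have "of_nat (d k) * of_int (C' $ k $ k) = form' (\<alpha>' k) (\<alpha>' k)"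
      using form' False by (simp add: standard_form_def normalized_mult_def)
    also have "\<dots> = form (\<alpha> k) (\<alpha> k)"
      using \<phi>_form[OF \<alpha> \<alpha>, of k k] False by (simp add: \<phi>_\<alpha>)
    also have "\<dots> = of_nat (d k) * 2"
      by (simp add: coroot[OF \<alpha>] \<alpha>2)
    finally have "(of_int (C' $ k $ k) :: complex) = of_int 2"
      using d[of k] by simp
    then show ?thesis by (simp only: of_int_eq_iff)
  next
    case True
    have "of_int (C' $ i $ i) = form' (\<alpha>' i) (\<alpha>' i)"
      using form' by (simp add: standard_form_def normalized_mult_def)
    also have "\<dots> = form \<beta> \<beta>"
      using \<phi>_form[OF \<beta> \<beta>] by (simp add: \<phi>_\<beta>)
    also have "\<dots> = form (\<alpha> i) \<beta> + form (\<alpha> j) \<beta>"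
      using form_add[OF \<beta> \<alpha>[of i] \<alpha>[of j]] form_sym[OF \<beta> \<alpha> \<beta>] by (simp add: \<beta>_def)
    also have "\<dots> = of_int 2"
      using ij by (simp add: coroot[OF \<beta>] dj) (simp add: \<beta>_def \<alpha>_i i_\<alpha> \<alpha>2)
    finally show ?thesis using True by (simp only: of_int_eq_iff)
  qed
  have \<alpha>'2: "\<alpha>' k (\<alpha>v' k) = 2" for k
    by (simp add: \<alpha>'_C C'2)
  have coroot': "form' (\<alpha>' k) f = of_nat (normalized_mult d i k) * f (\<alpha>v' k)" if "f \<in> ?V'" for k f
    by (rule standard_form_coroot[OF form' \<alpha>' \<alpha>'2 C'2 that])
  have \<phi>_coroot: "\<phi> g (\<alpha>v' k) = g (\<alpha>v k)" if "g \<in> ?V" "k \<noteq> i" for g k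
    using coroot'[OF V'[OF that(1)], of k] coroot[OF that(1), of k] \<phi>_form[OF \<alpha> that(1), of k] that(2) d[of k]
    by (simp add: normalized_mult_def \<phi>_\<alpha>)
  \<comment> \<open>The normalized multiplicity at \<open>i\<close> is 1, so evaluation at
    \<open>\<alpha>v' i\<close> is pairing with \<open>\<alpha>' i = \<phi> \<beta>\<close>. Thus
    \<open>\<alpha>v' i\<close> corresponds to \<open>d i\<close> times \<open>\<alpha>v i\<close>
    plus \<open>\<alpha>v j\<close>.\<close>
  have \<phi>_coroot_i: "\<phi> g (\<alpha>v' i) = of_nat (d i) * g (\<alpha>v i) + g (\<alpha>v j)" if g: "g \<in> ?V" for g
  proof -
    have "\<phi> g (\<alpha>v' i) = form' (\<alpha>' i) (\<phi> g)"
      by (simp add: coroot'[OF V'[OF g]] normalized_mult_def)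
    also have "\<dots> = form \<beta> g"
      using \<phi>_form[OF \<beta> g] by (simp add: \<phi>_\<beta>)
    also have "\<dots> = form (\<alpha> i) g + form (\<alpha> j) g"
      using form_add[OF g \<alpha>[of i] \<alpha>[of j]] form_sym[OF \<beta> g g] form_sym[OF \<alpha> g g]
      by (simp add: \<beta>_def)
    finally show ?thesis by (simp add: coroot[OF g] dj)
  qed

  \<comment> \<open>The image of the reflection at the pole vertex\<close>
  define \<tau> where "\<tau> = ?T (?s i)"
  have s_GL: "?s k \<in> carrier ?G" and s'_GL: "?s' k \<in> carrier ?G'"
    and s'_inv: "?s' k \<otimes>\<^bsub>?G'\<^esub> ?s' k = \<one>\<^bsub>?G'\<^esub>" for k
    by (simp_all add: simple_reflection_GL simple_reflection_involution \<alpha> \<alpha>2 \<alpha>' \<alpha>'2)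
  note T_hom = transport_hom[OF \<phi>_bij \<phi>_linear]
  interpret T: group_hom ?G ?G' ?T
    by (simp add: group_hom_def group_hom_axioms_def G.is_group G'.is_group T_hom)
  have \<tau>_GL: "\<tau> \<in> carrier ?G'"
    unfolding \<tau>_def by (rule T.hom_closed[OF s_GL])
  have \<tau>_inv: "\<tau> \<otimes>\<^bsub>?G'\<^esub> \<tau> = \<one>\<^bsub>?G'\<^esub>"
    unfolding \<tau>_def using T.hom_mult[OF s_GL s_GL, of i i]
    by (simp add: simple_reflection_involution \<alpha> \<alpha>2)
  have T_s: "?T (?s k) (\<phi> g) = (\<lambda>x. \<phi> g x - g (\<alpha>v k) * \<phi> (\<alpha> k) x)" if "g \<in> ?V" for k g
    using that
    by (simp add: transport_apply[OF \<phi>_bij] simple_reflection_apply linear_on_dual_diff_scale[OF \<phi>_linear _ \<alpha>])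
  have T_s_k: "?T (?s k) = ?s' k" if "k \<noteq> i" for k
  proof (rule GL_dual_eqI[OF T.hom_closed[OF s_GL] s'_GL])
    fix f assume "f \<in> ?V'"
    then obtain g where "g \<in> ?V" "f = \<phi> g" using \<phi>_surj by blast
    then show "?T (?s k) f = ?s' k f"
      using that by (simp add: T_s \<phi>_\<alpha> \<phi>_coroot simple_reflection_apply V')
  qed
  have \<tau>_apply: "\<tau> (\<phi> g) = (\<lambda>x. \<phi> g x - g (\<alpha>v i) * (\<alpha>' i x - \<alpha>' j x))" if "g \<in> ?V" for g
    using that by (simp add: \<tau>_def T_s \<phi>_\<alpha>_i)
  \<comment> \<open>The coefficient \<open>g (\<alpha>v i)\<close> in \<open>\<tau>_apply\<close> is
    \<open>2 - 1 = 1\<close> for \<open>g = \<beta>\<close>, -1 for \<open>g = \<alpha> j\<close>,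
    and 0 for the simple roots at the remaining indices.\<close>
  have \<tau>_\<alpha>': "\<tau> (\<alpha>' k) = \<alpha>' (\<sigma> k)" for k
  proof (cases "k = i")
    case True
    then show ?thesis
      using \<tau>_apply[OF \<beta>] ij by (simp add: \<phi>_\<beta> \<sigma>_def) (simp add: \<beta>_def \<alpha>_i)
  next
    case False
    then show ?thesis
      using \<tau>_apply[OF \<alpha>, of k] by (auto simp: \<phi>_\<alpha> \<sigma>_def \<alpha>_i Transposition.transpose_def)
  qed
  \<comment> \<open>Passing from \<open>g\<close> to \<open>h = ?s i g\<close> negates the value at
    \<open>\<alpha>v i\<close> and adds \<open>d i * g (\<alpha>v i)\<close> to the value at
    \<open>\<alpha>v j\<close>. This exchanges
    \<open>d i * g (\<alpha>v i) + g (\<alpha>v j)\<close> with \<open>g (\<alpha>v j)\<close>, the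
    values of \<open>\<phi> g\<close> at \<open>\<alpha>v' i\<close> and
    \<open>\<alpha>v' j\<close>.\<close>
  have \<tau>_coroot: "\<tau> (\<phi> g) (\<alpha>v' k) = \<phi> g (\<alpha>v' (\<sigma> k))" if g: "g \<in> ?V" for g k
  proof -
    define h where "h = ?s i g"
    have h: "h \<in> ?V" by (simp add: h_def simple_reflection_closed \<alpha> g)
    have \<tau>: "\<tau> (\<phi> g) = \<phi> h"
      by (simp add: h_def \<tau>_def transport_apply[OF \<phi>_bij g])
    have h_coroot: "h (\<alpha>v l) = g (\<alpha>v l) - g (\<alpha>v i) * \<alpha> i (\<alpha>v l)" for l
      by (simp add: h_def simple_reflection_apply[OF g])
    show ?thesis
      using ij
      by (auto simp: \<tau> \<phi>_coroot[OF h] \<phi>_coroot_i[OF h] \<phi>_coroot[OF g] \<phi>_coroot_i[OF g]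
          h_coroot i_\<alpha> \<sigma>_def Transposition.transpose_def algebra_simps)
  qed
  \<comment> \<open>Apply the linear involution \<open>\<tau>\<close> to the expansion of
    \<open>?s' k (\<tau> f)\<close>: \<open>\<tau>_\<alpha>'\<close> moves the index of the root to
    \<open>\<sigma> k\<close>, and \<open>\<tau>_coroot\<close> moves that of the coroot.\<close>
  have conj: "\<tau> \<otimes>\<^bsub>?G'\<^esub> ?s' k \<otimes>\<^bsub>?G'\<^esub> \<tau> = ?s' (\<sigma> k)" for k
  proof (rule GL_dual_eqI)
    fix f assume f: "f \<in> ?V'"
    then obtain g where g: "g \<in> ?V" "f = \<phi> g" using \<phi>_surj by blast
    have \<tau>_lin: "linear_on_dual sc' \<tau>" using \<tau>_GL by (simp add: carrier_GL_dual)
    have \<tau>f: "\<tau> f \<in> ?V'" by (rule GL_dual_closed[OF \<tau>_GL f])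
    have \<tau>\<tau>: "\<tau> (\<tau> f) = f"
      using fun_cong[OF \<tau>_inv, of f] f by (simp add: mult_GL_dual \<tau>_GL one_GL_dual)
    have "(\<tau> \<otimes>\<^bsub>?G'\<^esub> ?s' k \<otimes>\<^bsub>?G'\<^esub> \<tau>) f = \<tau> (?s' k (\<tau> f))"
      using f \<tau>f by (simp add: mult_GL_dual_apply \<tau>_GL s'_GL)
    also have "\<dots> = (\<lambda>x. f x - \<tau> f (\<alpha>v' k) * \<alpha>' (\<sigma> k) x)"
      by (simp add: simple_reflection_apply[OF \<tau>f] linear_on_dual_diff_scale[OF \<tau>_lin \<tau>f \<alpha>'] \<tau>\<tau> \<tau>_\<alpha>')
    also have "\<dots> = ?s' (\<sigma> k) f"
      using \<tau>_coroot[OF g(1)] by (simp add: simple_reflection_apply[OF f] flip: g(2))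
    finally show "(\<tau> \<otimes>\<^bsub>?G'\<^esub> ?s' k \<otimes>\<^bsub>?G'\<^esub> \<tau>) f = ?s' (\<sigma> k) f" .
  qed (simp_all add: \<tau>_GL s'_GL)

  \<comment> \<open>Both Weyl groups as generated subgroups, and normalization by the
    involution\<close>
  define N where "N = generate ?G' (range ?s')"
  have range_s': "range ?s' \<subseteq> carrier ?G'" using s'_GL by blast
  have W': "W' = ?G'\<lparr>carrier := N\<rparr>"
    unfolding W'_def N_def by (rule weyl_group_eq[OF \<alpha>' \<alpha>'2])
  have W: "W = ?G\<lparr>carrier := generate ?G (range ?s)\<rparr>"
    unfolding W_def by (rule weyl_group_eq[OF \<alpha> \<alpha>2])
  have N: "subgroup N ?G'"
    unfolding N_def by (rule G'.generate_is_subgroup[OF range_s'])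
  have normS: "\<tau> \<otimes>\<^bsub>?G'\<^esub> s \<otimes>\<^bsub>?G'\<^esub> \<tau> \<in> range ?s'" if "s \<in> range ?s'" for s
    using that conj by auto
  have normN: "\<tau> \<otimes>\<^bsub>?G'\<^esub> n \<otimes>\<^bsub>?G'\<^esub> \<tau> \<in> N" if "n \<in> N" for n
    using G'.conj_involution_generate[OF range_s' \<tau>_GL \<tau>_inv normS] that by (simp add: N_def)

  \<comment> \<open>The involution lies outside the Weyl group of the normalization\<close>
  have "\<tau> \<notin> N"
  proof
    assume "\<tau> \<in> N"
    \<comment> \<open>A fundamental weight at \<open>i\<close>. With \<open>f = \<phi> g\<close>,
      its value 0 at \<open>\<alpha>v' j\<close> gives \<open>g (\<alpha>v j) = 0\<close>, and then
      its value 1 at \<open>\<alpha>v' i\<close> gives \<open>g (\<alpha>v i) = 1 / d i\<close>. So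
      \<open>\<tau>\<close> subtracts a fractional multiple of
      \<open>\<alpha>' i - \<alpha>' j\<close>.\<close>
    obtain f where f: "f \<in> ?V'" "\<And>k. f (\<alpha>v' k) = (if k = i then 1 else 0)"
      using cartan_realization_functional[OF real', of "\<lambda>k. if k = i then 1 else 0"] by blast
    obtain g where g: "g \<in> ?V" "f = \<phi> g" using f(1) \<phi>_surj by blast
    obtain v where v: "\<tau> f = (\<lambda>x. f x + root_comb \<alpha>' v x)"
    proof (rule weyl_group_root_lattice[OF \<alpha>' \<alpha>'2 _ _ f(1)])
      show "\<tau> \<in> carrier (weyl_group sc' \<alpha>' \<alpha>v')"
        using \<open>\<tau> \<in> N\<close> W' by (simp add: W'_def)
    qed (auto simp: \<alpha>'_C f(2))
    have gi: "of_nat (d i) * g (\<alpha>v i) = 1"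
      using \<phi>_coroot_i[OF g(1)] \<phi>_coroot[OF g(1), of j] f(2)[of i] f(2)[of j] ij g(2) by simp
    \<comment> \<open>The coefficients of the relation that equates the two expressions for
      \<open>\<tau> f\<close>. Independence of the simple roots forces \<open>c i = 0\<close>, that
      is \<open>v i = - 1 / d i\<close>; clearing the denominator gives
      \<open>d i * (- v i) = 1\<close> in the integers, impossible for
      \<open>d i > 1\<close>.\<close>
    define c where "c k = of_int (v k) + g (\<alpha>v i) * ((if k = i then 1 else 0) - (if k = j then 1 else 0))" for k
    have "(\<Sum>k\<in>UNIV. c k * \<alpha>' k x) = root_comb \<alpha>' v x + g (\<alpha>v i) * (\<alpha>' i x - \<alpha>' j x)" for x
    proof -
      have "(\<Sum>k\<in>UNIV. c k * \<alpha>' k x) = root_comb \<alpha>' v x +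
          g (\<alpha>v i) * (\<Sum>k\<in>UNIV. (if k = i then \<alpha>' k x else 0) - (if k = j then \<alpha>' k x else 0))"
        unfolding c_def root_comb_def sum_distrib_left sum.distrib[symmetric]
        by (intro sum.cong) (auto simp: algebra_simps)
      then show ?thesis by (simp add: sum_subtractf)
    qed
    moreover have "root_comb \<alpha>' v x + g (\<alpha>v i) * (\<alpha>' i x - \<alpha>' j x) = 0" for x
      using fun_cong[OF v, of x] \<tau>_apply[OF g(1)] g(2) by (simp add: algebra_simps)
    ultimately have "c i = 0"
      using real' by (simp add: cartan_realization_def)
    then have "of_int (v i) = - g (\<alpha>v i)"
      using ij by (simp add: c_def add_eq_0_iff2)
    then have "(of_int (int (d i) * (- v i)) :: complex) = of_int 1"
      using gi by simp
    then have "int (d i) * (- v i) = 1" by (simp only: of_int_eq_iff)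
    then show False
      using di by (metis dvd_triv_left int_dvd_int_iff nat_dvd_1_iff_1 of_nat_1 less_irrefl)
  qed

  \<comment> \<open>The image of the Weyl group under transport\<close>
  have "generate ?G' (?T ` range ?s) = generate ?G' (insert \<tau> (range ?s'))"
  proof
    have "?T (?s k) \<in> insert \<tau> (range ?s')" for k
      using T_s_k[of k] by (cases "k = i") (auto simp: \<tau>_def)
    then have "?T ` range ?s \<subseteq> insert \<tau> (range ?s')" by blast
    then show "generate ?G' (?T ` range ?s) \<subseteq> generate ?G' (insert \<tau> (range ?s'))"
      by (rule G'.mono_generate)
    have \<tau>: "\<tau> \<in> generate ?G' (?T ` range ?s)"
      by (auto simp: \<tau>_def intro: generate.incl)
    have s': "?s' k \<in> generate ?G' (?T ` range ?s)" if "k \<noteq> i" for k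
      using T_s_k[OF that] by (metis generate.incl rangeI imageI)
    \<comment> \<open>\<open>?s' i\<close> is the generator that \<open>T_s_k\<close> does not
      reach. It is a conjugate of \<open>?s' j\<close>, which is reached because
      \<open>j \<noteq> i\<close>.\<close>
    have "?s' i = \<tau> \<otimes>\<^bsub>?G'\<^esub> ?s' j \<otimes>\<^bsub>?G'\<^esub> \<tau>"
      using conj[of j] by (simp add: \<sigma>_def)
    then have s'_i: "?s' i \<in> generate ?G' (?T ` range ?s)"
      using \<tau> s'[of j] ij by (auto intro: generate.eng)
    have "?s' k \<in> generate ?G' (?T ` range ?s)" for k
      using s'_i s'[of k] by (cases "k = i") simp_all
    then have "insert \<tau> (range ?s') \<subseteq> generate ?G' (?T ` range ?s)"
      using \<tau> by blast
    then show "generate ?G' (insert \<tau> (range ?s')) \<subseteq> generate ?G' (?T ` range ?s)"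
      using s_GL by (intro G'.generate_subgroup_incl G'.generate_is_subgroup) auto
  qed
  also have "\<dots> = N \<union> (\<lambda>n. n \<otimes>\<^bsub>?G'\<^esub> \<tau>) ` N"
    unfolding N_def by (rule G'.generate_insert_involution[OF range_s' \<tau>_GL \<tau>_inv normS])
  finally have image: "?T ` generate ?G (range ?s) = N \<union> (\<lambda>n. n \<otimes>\<^bsub>?G'\<^esub> \<tau>) ` N"
    using T.generate_img[of "range ?s"] s_GL by (simp add: image_subset_iff)
  have W_sub: "generate ?G (range ?s) \<subseteq> carrier ?G"
    using G.generate_incl[of "range ?s"] s_GL by blast
  \<comment> \<open>The common target: transport maps \<open>W\<close> onto it, and \<open>F\<close>
    below maps the semidirect product onto it.\<close>
  define H where "H = ?G'\<lparr>carrier := N \<union> (\<lambda>n. n \<otimes>\<^bsub>?G'\<^esub> \<tau>) ` N\<rparr>"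
  have T_iso: "?T \<in> iso W H"
  proof (rule isoI)
    show "?T \<in> hom W H"
      using image W_sub by (intro homI) (auto simp: W H_def subset_iff)
    show "bij_betw ?T (carrier W) (carrier H)"
      using image inj_on_subset[OF transport_inj[OF \<phi>_bij] W_sub] by (simp add: W H_def bij_betw_def)
  qed

  \<comment> \<open>The isomorphism with the semidirect product\<close>
  define \<theta> where "\<theta> = (\<lambda>e::int. \<lambda>n\<in>N. \<tau> [^]\<^bsub>?G'\<^esub> e \<otimes>\<^bsub>?G'\<^esub> n \<otimes>\<^bsub>?G'\<^esub> \<tau> [^]\<^bsub>?G'\<^esub> e)"
  define F where "F = (\<lambda>(n, e::int). n \<otimes>\<^bsub>?G'\<^esub> \<tau> [^]\<^bsub>?G'\<^esub> e)"
  define S where "S = semidirect_product W' (integer_mod_group 2) \<theta>"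
  have \<theta>_hom: "\<theta> \<in> hom (integer_mod_group 2) (AutoGroup W')"
    unfolding \<theta>_def W' by (rule G'.involution_semidirect_hom[OF N \<tau>_GL \<tau>_inv normN])
  have F_iso: "F \<in> iso S H"
    unfolding F_def S_def H_def \<theta>_def W'
    by (rule G'.involution_semidirect_iso[OF N \<tau>_GL \<tau>_inv \<open>\<tau> \<notin> N\<close> normN])
  have bij: "bij_betw F (carrier S) (carrier H)" and F_hom: "F \<in> hom S H"
    using F_iso by (auto simp: iso_def)
  \<comment> \<open>As \<open>F (u, e)\<close> is \<open>u\<close> times a power of
    \<open>\<tau>\<close>, inverting \<open>F\<close> after transport makes the required
    factorization of \<open>?T w\<close> hold by construction.\<close>
  define \<Psi> where "\<Psi> = (\<lambda>w. inv_into (carrier S) F (?T w))"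
  have TW: "?T w \<in> carrier H" if "w \<in> carrier W" for w
    using T_iso that by (auto simp: iso_def bij_betw_def)
  have \<Psi>: "\<Psi> w \<in> carrier S" "F (\<Psi> w) = ?T w" if "w \<in> carrier W" for w
    using bij TW[OF that] by (auto simp: \<Psi>_def bij_betw_def inv_into_into f_inv_into_f)
  \<comment> \<open>Multiplicativity of \<open>\<Psi>\<close> will follow by cancelling
    \<open>F\<close>, which is injective on the carrier of \<open>S\<close> only, so products must
    be known to stay there. They do because each \<open>\<theta> e\<close> is an automorphism of
    \<open>W'\<close>.\<close>
  have S_closed: "x \<otimes>\<^bsub>S\<^esub> y \<in> carrier S" if "x \<in> carrier S" "y \<in> carrier S" for x y
  proof -
    have "\<theta> e m \<in> N" if "e \<in> carrier (integer_mod_group 2)" "m \<in> N" for e m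
      using hom_in_carrier[OF \<theta>_hom that(1)] that(2) hom_in_carrier[of "\<theta> e" W' W' m]
      by (simp add: AutoGroup_def auto_def) (simp add: W')
    then show ?thesis
      using that subgroup.m_closed[OF N]
      by (auto simp: S_def semidirect_product_def W' carrier_integer_mod_group)
  qed
  have "\<Psi> \<in> iso W S"
  proof (rule isoI)
    have "bij_betw ?T (carrier W) (carrier H)"
      using T_iso by (simp add: iso_def)
    from bij_betw_trans[OF this bij_betw_inv_into[OF bij]]
    show "bij_betw \<Psi> (carrier W) (carrier S)"
      by (simp add: \<Psi>_def comp_def)
    show "\<Psi> \<in> hom W S"
    proof (rule homI)
      fix w u assume w: "w \<in> carrier W" and u: "u \<in> carrier W"
      have wu: "w \<otimes>\<^bsub>W\<^esub> u \<in> carrier W"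
        using w u by (auto simp: W intro: generate.eng)
      have "F (\<Psi> w \<otimes>\<^bsub>S\<^esub> \<Psi> u) = ?T w \<otimes>\<^bsub>H\<^esub> ?T u"
        using hom_mult[OF F_hom \<Psi>(1)[OF w] \<Psi>(1)[OF u]] by (simp add: \<Psi>(2) w u)
      also have "\<dots> = F (\<Psi> (w \<otimes>\<^bsub>W\<^esub> u))"
        using hom_mult[of ?T W H w u] T_iso w u by (simp add: iso_def \<Psi>(2)[OF wu])
      finally show "\<Psi> (w \<otimes>\<^bsub>W\<^esub> u) = \<Psi> w \<otimes>\<^bsub>S\<^esub> \<Psi> u"
        using bij \<Psi>(1)[OF wu] S_closed[OF \<Psi>(1)[OF w] \<Psi>(1)[OF u]]
        by (auto simp: bij_betw_def inj_on_def)
    qed (rule \<Psi>(1))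
  qed
  moreover have "\<theta> 1 (?s' k) = ?s' (\<sigma> k)" for k
    using conj[of k] \<tau>_GL by (simp add: \<theta>_def N_def generate.incl)
  moreover have "?T w = u \<otimes>\<^bsub>?G'\<^esub> (\<tau> [^]\<^bsub>?G'\<^esub> e)" if "w \<in> carrier W" "\<Psi> w = (u, e)" for w u e
    using \<Psi>(2)[OF that(1)] that(2) by (simp add: F_def)
  ultimately show ?thesis
    using \<theta>_hom \<tau>_GL \<tau>_\<alpha>' unfolding S_def by blast
qed

end
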